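(* Let $T$ be a tree containing at least one branch vertex. For each leaf $u$ of $T$, let $\ell(u)$ denote the length of the leg of $T$ determined by $u$. Then $$r_{\mu}(T)=\prod_{u\in\mathcal{L}(T)}\ell(u).$$
   Context: All graphs are finite, simple, undirected and connected. For a graph $G$ and $X\subseteq V(G)$, two vertices $u,v$ are $X$-visible if there is a shortest $(u,v)$-path in $G$ all of whose internal vertices lie outside $X$. A set $X\subseteq V(G)$ is a mutual-visibility set of $G$ if every pair of vertices of $X$ is $X$-visible. The mutual-visibility number $\mu(G)$ is the maximum cardinality of a mutual-visibility set of $G$, and $r_\mu(G)$ is the number of mutual-visibility sets of $G$ of cardinality $\mu(G)$. A tree is a connected graph with no cycles. In a tree $T$, a leaf is a vertex of degree one and a branch vertex is a vertex of degree at least three; $\mathcal{L}(T)$ is the set of leaves. The leg of $T$ determined by a leaf $u$ is the unique path in $T$ joining $u$ to its nearest branch vertex $b(u)$; its length is its number of edges. *)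

theory Defs
  imports
    "Graph_Theory.Pair_Digraph"
    "Graph_Theory.Digraph_Component"
    "Graph_Theory.Vertex_Walk"
begin

text \<open>
  A finite simple undirected graph is a finite, symmetric, loop-free set of arcs
  (\<open>pair_graph\<close>): the edge \<open>uv\<close> is the pair of arcs \<open>(u,v)\<close>, \<open>(v,u)\<close>.
  Consequently the degree of a vertex is its \<open>out_degree\<close>.

  The predicate \<open>tree\<close> of \<open>Digraph_Component\<close> is not usable here: its cycles are
  directed, so that \<open>u, v, u\<close> counts as a cycle and a symmetric digraph with an arc
  is never a \<open>tree\<close>. Undirected cycles have at least three vertices.
\<close>

definition undirected_cycle :: "'a pair_pre_digraph \<Rightarrow> 'a vwalk \<Rightarrow> bool" where
  "undirected_cycle G c \<longleftrightarrow>
     vpath c (with_proj G) \<and> 3 \<le> length c \<and> (last c, hd c) \<in> parcs G"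

definition undirected_tree :: "'a pair_pre_digraph \<Rightarrow> bool" where
  "undirected_tree G \<longleftrightarrow>
     pair_graph G \<and> Digraph_Component.connected (with_proj G) \<and> (\<nexists>c. undirected_cycle G c)"

definition vpath_between :: "'a pair_pre_digraph \<Rightarrow> 'a \<Rightarrow> 'a vwalk \<Rightarrow> 'a \<Rightarrow> bool" where
  "vpath_between G u p v \<longleftrightarrow> vpath p (with_proj G) \<and> hd p = u \<and> last p = v"

definition shortest_vpath :: "'a pair_pre_digraph \<Rightarrow> 'a \<Rightarrow> 'a vwalk \<Rightarrow> 'a \<Rightarrow> bool" where
  "shortest_vpath G u p v \<longleftrightarrow>
     vpath_between G u p v \<and>
     (\<forall>q. vpath_between G u q v \<longrightarrow> vwalk_length p \<le> vwalk_length q)"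

definition internal_verts :: "'a vwalk \<Rightarrow> 'a set" where
  "internal_verts p = set (butlast (tl p))"

definition visible :: "'a pair_pre_digraph \<Rightarrow> 'a set \<Rightarrow> 'a \<Rightarrow> 'a \<Rightarrow> bool" where
  "visible G X u v \<longleftrightarrow> (\<exists>p. shortest_vpath G u p v \<and> internal_verts p \<inter> X = {})"

definition mutual_visibility_set :: "'a pair_pre_digraph \<Rightarrow> 'a set \<Rightarrow> bool" where
  "mutual_visibility_set G X \<longleftrightarrow> X \<subseteq> pverts G \<and> (\<forall>u\<in>X. \<forall>v\<in>X. visible G X u v)"

definition mutual_visibility_number :: "'a pair_pre_digraph \<Rightarrow> nat" where
  "mutual_visibility_number G = Max (card ` {X. mutual_visibility_set G X})"

definition r_mu :: "'a pair_pre_digraph \<Rightarrow> nat" where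
  "r_mu G = card {X. mutual_visibility_set G X \<and> card X = mutual_visibility_number G}"

definition leaves :: "'a pair_pre_digraph \<Rightarrow> 'a set" where
  "leaves G = {u \<in> pverts G. out_degree (with_proj G) u = 1}"

definition branch_verts :: "'a pair_pre_digraph \<Rightarrow> 'a set" where
  "branch_verts G = {u \<in> pverts G. 3 \<le> out_degree (with_proj G) u}"

definition graph_dist :: "'a pair_pre_digraph \<Rightarrow> 'a \<Rightarrow> 'a \<Rightarrow> nat" where
  "graph_dist G u v = (LEAST n. \<exists>p. vpath_between G u p v \<and> vwalk_length p = n)"

text \<open>
  For a leaf of a tree with a branch vertex, both descriptions below are uniquely
  satisfied: the first branch vertex met on the way from the leaf lies on every path
  from the leaf to another branch vertex.
\<close>

definition nearest_branch_vert :: "'a pair_pre_digraph \<Rightarrow> 'a \<Rightarrow> 'a" where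
  "nearest_branch_vert G u =
     (THE b. b \<in> branch_verts G \<and>
        (\<forall>c\<in>branch_verts G. graph_dist G u b \<le> graph_dist G u c))"

definition leg :: "'a pair_pre_digraph \<Rightarrow> 'a \<Rightarrow> 'a vwalk" where
  "leg G u = (THE p. vpath_between G u p (nearest_branch_vert G u))"

definition leg_length :: "'a pair_pre_digraph \<Rightarrow> 'a \<Rightarrow> nat" where
  "leg_length G u = vwalk_length (leg G u)"

end

theory Submission
  imports Defs "HOL-Library.Sublist" "HOL-Library.FuncSet"
begin

text \<open>
  A set \<open>X\<close> is mutually visible iff no \<open>x \<in> X\<close> separates two other members of \<open>X\<close>. Hence
  \<open>X - {x}\<close> lies in one component of the tree minus \<open>x\<close>; let \<open>S x\<close> be the set of leaves
  outside that component (it contains \<open>x\<close> if \<open>x\<close> is a leaf). If \<open>X\<close> has at least two elements,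
  the sets \<open>S x\<close> are nonempty and disjoint, so \<open>X\<close> has at most as many elements as there
  are leaves. In case of equality every \<open>S x\<close> is a singleton \<open>{u}\<close>, and then no branch vertex
  separates \<open>u\<close> from \<open>x\<close> or equals \<open>x\<close>, since it would put a second leaf into \<open>S x\<close>. So
  \<open>x\<close> lies on the leg of \<open>u\<close> and is not its branch end. Conversely, a vertex of a leg other
  than its branch end separates only vertices of that same leg from the rest, so choosing one
  such vertex on every leg gives a mutual-visibility set.
\<close>

subsection \<open>Paths and separation\<close>

lemma vwalk_iff_successively:
  "vwalk p (with_proj G) \<longleftrightarrow>
     p \<noteq> [] \<and> set p \<subseteq> pverts G \<and> successively (\<lambda>a b. (a, b) \<in> parcs G) p"
proof -
  have "set (vwalk_arcs p) \<subseteq> parcs G \<longleftrightarrow> successively (\<lambda>a b. (a, b) \<in> parcs G) p"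
    by (induction p rule: vwalk_arcs.induct) auto
  then show ?thesis
    by (auto simp: vwalk_def)
qed

lemma vpath_between_iff:
  "vpath_between G u p v \<longleftrightarrow>
     p \<noteq> [] \<and> set p \<subseteq> pverts G \<and> successively (\<lambda>a b. (a, b) \<in> parcs G) p \<and> distinct p \<and>
     hd p = u \<and> last p = v"
  by (auto simp: vpath_between_def vpath_def vwalk_iff_successively)

section \<open>Neighbourhoods and connectivity in a tree\<close>

locale undirected_tree_graph =
  fixes G :: "'a pair_pre_digraph"
  assumes tree: "undirected_tree G"
begin

lemma pair_graph: "pair_graph G"
  using tree by (simp add: undirected_tree_def)

lemma finite_pverts: "finite (pverts G)"
  using pair_graph by (simp add: pair_graph_def pair_digraph_def pair_fin_digraph_def
      pair_fin_digraph_axioms_def)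

lemma arc_in_pverts: "(u, v) \<in> parcs G \<Longrightarrow> u \<in> pverts G \<and> v \<in> pverts G"
  using pair_graph pair_wf_digraph.wellformed'
  by (metis pair_digraph.pair_wf_digraph pair_graph.axioms(1))

lemma arc_sym: "(u, v) \<in> parcs G \<Longrightarrow> (v, u) \<in> parcs G"
  using pair_graph pair_sym_digraph.arcs_symmetric
  by (metis pair_graph.axioms(2) pair_pseudo_graph.axioms(2))

lemma arc_neq: "(u, v) \<in> parcs G \<Longrightarrow> u \<noteq> v"
  using pair_graph pair_loopfree_digraph.no_loops'
  by (metis pair_graph.axioms(1) pair_digraph.axioms(2))

definition nbrs :: "'a \<Rightarrow> 'a set" where
  "nbrs u = {v. (u, v) \<in> parcs G}"

lemma finite_nbrs: "finite (nbrs u)"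
  by (rule finite_subset[OF _ finite_pverts]) (auto simp: nbrs_def dest: arc_in_pverts)

lemma out_degree_eq_card_nbrs: "out_degree (with_proj G) u = card (nbrs u)"
proof -
  have "out_arcs (with_proj G) u = Pair u ` nbrs u"
    by (auto simp: out_arcs_def nbrs_def)
  then show ?thesis
    by (simp add: out_degree_def card_image inj_on_def)
qed

lemma mem_leaves_iff: "u \<in> leaves G \<longleftrightarrow> u \<in> pverts G \<and> card (nbrs u) = 1"
  by (simp add: leaves_def out_degree_eq_card_nbrs)

lemma mem_branch_verts_iff: "u \<in> branch_verts G \<longleftrightarrow> u \<in> pverts G \<and> 3 \<le> card (nbrs u)"
  by (simp add: branch_verts_def out_degree_eq_card_nbrs)

lemma finite_leaves: "finite (leaves G)"
  using finite_subset[OF _ finite_pverts] by (auto simp: leaves_def)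

lemma ex_other_nbr:
  assumes "card (nbrs x) \<noteq> 1" "a \<in> nbrs x"
  shows "\<exists>c\<in>nbrs x. c \<noteq> a"
proof (rule ccontr)
  assume "\<not> ?thesis"
  then have "nbrs x = {a}"
    using assms(2) by blast
  then show False
    using assms(1) by simp
qed

text \<open>The set \<open>S\<close> keeps the path away from a deleted vertex;
  \<open>S = UNIV\<close> gives plain connectivity. Membership of \<open>u\<close> in
  \<open>pverts G\<close> is demanded because the reflexive closure also relates non-vertices to
  themselves.\<close>

lemma rtrancl_imp_vpath_between:
  assumes "(u, v) \<in> (parcs G \<inter> S \<times> S)\<^sup>*" "u \<in> pverts G \<inter> S"
  shows "\<exists>p. vpath_between G u p v \<and> set p \<subseteq> S"
proof -
  have "\<exists>p. vwalk p (with_proj G) \<and> hd p = u \<and> last p = v \<and> set p \<subseteq> S"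
    using assms(1)
  proof (induction rule: rtrancl_induct)
    case base
    then show ?case
      using assms(2) by (intro exI[of _ "[u]"]) auto
  next
    case (step y z)
    then obtain p where p: "vwalk p (with_proj G)" "hd p = u" "last p = y" "set p \<subseteq> S"
      by blast
    then show ?case
      using step.hyps(2) arc_in_pverts
      by (intro exI[of _ "p @ [z]"])
        (auto simp: vwalk_iff_successively successively_append_iff)
  qed
  then obtain p where p: "vwalk p (with_proj G)" "hd p = u" "last p = v" "set p \<subseteq> S"
    by blast
  then show ?thesis
    using vwalk_to_vpath_vpath[OF p(1)] vwalk_to_vpath_subset[of _ p]
    by (intro exI[of _ "vwalk_to_vpath p"])
      (auto simp: vpath_between_def vwalk_to_vpath_hd vwalk_to_vpath_last)
qed

lemma ex_vpath_between:
  assumes "u \<in> pverts G" "v \<in> pverts G"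
  shows "\<exists>p. vpath_between G u p v"
proof -
  \<comment> \<open>\<open>connected\<close> speaks about the symmetric closure, which adds no arcs
    here.\<close>
  have arcs: "parcs (mk_symmetric (with_proj G)) = parcs G"
    by (auto simp: mk_symmetric_def dest: arc_sym)
  have "reachable (with_proj (mk_symmetric (with_proj G))) u v"
    using tree assms
    by (simp add: undirected_tree_def Digraph_Component.connected_def strongly_connected_def
        mk_symmetric_def)
  then have "(u, v) \<in> (parcs G)\<^sup>*"
    using reachable_rtranclI arcs by fastforce
  then show ?thesis
    using rtrancl_imp_vpath_between[of u v UNIV] assms by auto
qed

text \<open>
  Reachability in the tree with \<open>x\<close> deleted. As \<open>x\<close> is isolated in the relation,
  \<open>avoid x x v\<close> holds only for \<open>v = x\<close>.
\<close>

definition avoid :: "'a \<Rightarrow> 'a \<Rightarrow> 'a \<Rightarrow> bool" where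
  "avoid x u v \<longleftrightarrow> (u, v) \<in> (parcs G \<inter> (- {x}) \<times> (- {x}))\<^sup>*"

lemma avoid_refl [simp]: "avoid x u u"
  by (simp add: avoid_def)

lemma avoid_trans: "avoid x u v \<Longrightarrow> avoid x v w \<Longrightarrow> avoid x u w"
  unfolding avoid_def by (rule rtrancl_trans)

lemma avoid_sym: "avoid x u v \<Longrightarrow> avoid x v u"
proof -
  have "sym (parcs G \<inter> (- {x}) \<times> (- {x}))"
    by (auto simp: sym_def dest: arc_sym)
  then show "avoid x u v \<Longrightarrow> avoid x v u"
    unfolding avoid_def by (meson sym_rtrancl symD)
qed

lemma avoid_arc: "(u, v) \<in> parcs G \<Longrightarrow> u \<noteq> x \<Longrightarrow> v \<noteq> x \<Longrightarrow> avoid x u v"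
  unfolding avoid_def by (rule r_into_rtrancl) auto

lemma avoid_neq: "avoid x u v \<Longrightarrow> u \<noteq> x \<Longrightarrow> v \<noteq> x"
  unfolding avoid_def by (erule rtrancl_induct) auto

lemma avoid_pverts: "avoid x u v \<Longrightarrow> u \<in> pverts G \<Longrightarrow> v \<in> pverts G"
  unfolding avoid_def by (erule rtrancl_induct) (auto dest: arc_in_pverts)

lemma successively_avoid:
  assumes "p \<noteq> []" "successively (\<lambda>a b. (a, b) \<in> parcs G) p" "x \<notin> set p"
  shows "avoid x (hd p) (last p)"
  using assms
proof (induction p rule: induct_list012)
  case (3 a b p)
  then have "avoid x a b" "avoid x b (last (b # p))"
    by (auto intro: avoid_arc)
  then show ?case
    using avoid_trans[of x a b "last (b # p)"] by simp
qed auto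

text \<open>The one place where acyclicity enters: a path from \<open>a\<close> to \<open>b\<close>
  that misses \<open>x\<close> would close up through \<open>x\<close> to a cycle.\<close>

lemma nbrs_not_avoid:
  assumes "(x, a) \<in> parcs G" "(x, b) \<in> parcs G" "avoid x a b"
  shows "a = b"
proof (rule ccontr)
  assume "a \<noteq> b"
  have "a \<in> pverts G \<inter> - {x}"
    using assms(1) arc_in_pverts arc_neq by blast
  then obtain p where p: "vpath_between G a p b" "set p \<subseteq> - {x}"
    using rtrancl_imp_vpath_between[OF assms(3)[unfolded avoid_def]] by metis
  then have "length p \<ge> 2"
    using \<open>a \<noteq> b\<close> by (cases p rule: remdups_adj.cases) (auto simp: vpath_between_iff)
  then have "undirected_cycle G (x # p)"
    using p assms arc_in_pverts arc_sym[OF assms(2)]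
    by (auto simp: undirected_cycle_def vpath_between_iff vpath_def vwalk_iff_successively
        successively_Cons)
  then show False
    using tree by (auto simp: undirected_tree_def)
qed

text \<open>Were \<open>u\<close> and \<open>v\<close> joined off \<open>x\<close>, so would be the
  two neighbours of \<open>x\<close> on \<open>p\<close>. By \<open>nbrs_not_avoid\<close> these
  would coincide, but \<open>p\<close> is distinct.\<close>

lemma vpath_between_not_avoid:
  assumes p: "vpath_between G u p v" and x: "x \<in> set p" "x \<noteq> u" "x \<noteq> v"
  shows "\<not> avoid x u v"
proof
  assume "avoid x u v"
  obtain p1 p2 where dec: "p = p1 @ x # p2"
    using x(1) by (meson split_list)
  then have ne: "p1 \<noteq> []" "p2 \<noteq> []"
    using p x by (auto simp: vpath_between_iff)
  then have succ: "successively (\<lambda>a b. (a, b) \<in> parcs G) p1"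
      "successively (\<lambda>a b. (a, b) \<in> parcs G) p2"
      "(last p1, x) \<in> parcs G" "(x, hd p2) \<in> parcs G"
    and notin: "x \<notin> set p1" "x \<notin> set p2" and disj: "set p1 \<inter> set p2 = {}"
    and ends: "hd p1 = u" "last p2 = v"
    using p dec by (auto simp: vpath_between_iff successively_append_iff successively_Cons)
  have "avoid x u (last p1)" "avoid x (hd p2) v"
    using successively_avoid[OF ne(1) succ(1) notin(1)]
      successively_avoid[OF ne(2) succ(2) notin(2)] ends by simp_all
  then have "avoid x (last p1) (hd p2)"
    using \<open>avoid x u v\<close> by (meson avoid_sym avoid_trans)
  then have "last p1 = hd p2"
    using nbrs_not_avoid arc_sym succ(3,4) by blast
  then show False
    using disj ne by (metis disjoint_iff hd_in_set last_in_set)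
qed

text \<open>A path from \<open>u\<close> to \<open>x\<close> either misses \<open>x'\<close>, or its
  initial part up to \<open>x'\<close> misses \<open>x\<close>.\<close>

lemma avoid_trichotomy:
  assumes "x \<noteq> x'" "u \<in> pverts G" "x \<in> pverts G"
  shows "avoid x u x' \<or> avoid x' u x"
proof -
  obtain p where p: "vpath_between G u p x"
    using ex_vpath_between assms by blast
  show ?thesis
  proof (cases "x' \<in> set p")
    case False
    then show ?thesis
      using p successively_avoid[of p x'] by (auto simp: vpath_between_iff)
  next
    case True
    then obtain p1 p2 where dec: "p = (p1 @ [x']) @ p2"
      by (metis append.assoc append_Cons append_Nil split_list)
    then have "p2 \<noteq> []"
      using p assms(1) by (auto simp: vpath_between_iff)
    then have "x \<in> set p2"
      using p dec by (auto simp: vpath_between_iff)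
    then have "x \<notin> set (p1 @ [x'])"
      using p dec by (auto simp: vpath_between_iff)
    moreover have "successively (\<lambda>a b. (a, b) \<in> parcs G) (p1 @ [x'])" "hd (p1 @ [x']) = u"
      using p dec by (auto simp: vpath_between_iff successively_append_iff hd_append
          split: if_splits)
    ultimately show ?thesis
      using successively_avoid[of "p1 @ [x']" x] by auto
  qed
qed

section \<open>Leaves in the components left by deleting a vertex\<close>

lemma ex_nbr_avoid:
  assumes "x \<in> pverts G" "y \<in> pverts G" "x \<noteq> y"
  shows "\<exists>a. (x, a) \<in> parcs G \<and> avoid x a y"
proof -
  obtain p where p: "vpath_between G x p y"
    using ex_vpath_between assms by blast
  then obtain q where q: "p = x # q"
    by (cases p) (auto simp: vpath_between_iff)
  have "q \<noteq> []"
    using p q assms(3) by (auto simp: vpath_between_iff)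
  then show ?thesis
    using p q successively_avoid[of q x]
    by (intro exI[of _ "hd q"]) (auto simp: vpath_between_iff successively_Cons)
qed

text \<open>Induction on the size of the component of \<open>a\<close> after deleting
  \<open>x\<close>: unless \<open>a\<close> is a leaf, it has a neighbour \<open>c\<close> other
  than \<open>x\<close>, and the component of \<open>c\<close> after deleting \<open>a\<close> is
  smaller.\<close>

lemma ex_leaf_avoid:
  assumes "(x, a) \<in> parcs G"
  shows "\<exists>l\<in>leaves G. avoid x a l"
  using assms
proof (induction "card {w. avoid x a w}" arbitrary: x a rule: less_induct)
  case less
  have xa: "x \<in> nbrs a" "x \<noteq> a" "a \<in> pverts G"
    using less.prems arc_sym arc_neq arc_in_pverts by (auto simp: nbrs_def)
  show ?case
  proof (cases "card (nbrs a) = 1")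
    case True
    then have "a \<in> leaves G"
      using xa by (simp add: mem_leaves_iff)
    then show ?thesis
      using avoid_refl by blast
  next
    case False
    then obtain c where c: "c \<in> nbrs a" "c \<noteq> x"
      using ex_other_nbr xa(1) by blast
    then have ac: "(a, c) \<in> parcs G" "c \<noteq> a"
      using arc_neq by (auto simp: nbrs_def)
    \<comment> \<open>What lies beyond \<open>c\<close> cannot contain \<open>x\<close>, since
      \<open>c\<close> and \<open>x\<close> are distinct neighbours of \<open>a\<close>.\<close>
    have sub: "avoid x a w" if "avoid a c w" for w
      using that unfolding avoid_def[of a]
    proof (induction rule: rtrancl_induct)
      case base
      then show ?case
        using ac xa c by (intro avoid_arc) auto
    next
      case (step y z)
      then have "avoid a c z"
        unfolding avoid_def[of a] by (meson rtrancl.rtrancl_into_rtrancl)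
      then have "z \<noteq> x"
        using nbrs_not_avoid[OF ac(1), of x] c xa by (auto simp: nbrs_def)
      moreover have "y \<noteq> x"
        using avoid_neq[OF step.IH] xa by auto
      ultimately show ?case
        using avoid_arc[of y z x] step.hyps(2) step.IH avoid_trans by blast
    qed
    have "{w. avoid a c w} \<subset> {w. avoid x a w}"
      using sub avoid_neq[of a c a] ac avoid_refl[of x a] by blast
    moreover have "finite {w. avoid x a w}"
      using finite_subset[OF _ finite_pverts] avoid_pverts xa by blast
    ultimately have "card {w. avoid a c w} < card {w. avoid x a w}"
      by (rule psubset_card_mono[rotated])
    then obtain l where "l \<in> leaves G" "avoid a c l"
      using less.hyps[of a c] ac by blast
    then show ?thesis
      using sub by blast
  qed
qed

text \<open>Only one neighbour of \<open>b\<close> leads towards \<open>y\<close>. At least two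
  others remain, and each leads to a leaf in its own component.\<close>

lemma ex_two_leaves:
  assumes "b \<in> branch_verts G" "y \<in> pverts G" "y \<noteq> b"
  shows "\<exists>l\<in>leaves G. \<exists>l'\<in>leaves G. l \<noteq> l' \<and> \<not> avoid b l y \<and> \<not> avoid b l' y"
proof -
  obtain a where a: "(b, a) \<in> parcs G" "avoid b a y"
    using ex_nbr_avoid[of b y] assms by (auto simp: mem_branch_verts_iff)
  have "a \<in> nbrs b" "3 \<le> card (nbrs b)"
    using a(1) assms(1) by (simp_all add: nbrs_def mem_branch_verts_iff)
  then have "\<not> card (nbrs b - {a}) \<le> Suc 0"
    by simp
  then have "\<not> (\<forall>c\<in>nbrs b - {a}. \<forall>c'\<in>nbrs b - {a}. c = c')"
    using card_le_Suc0_iff_eq[of "nbrs b - {a}"] finite_nbrs by simp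
  then obtain c c' where c: "c \<in> nbrs b" "c' \<in> nbrs b" "c \<noteq> c'" "c \<noteq> a" "c' \<noteq> a"
    by blast
  then have bc: "(b, c) \<in> parcs G" "(b, c') \<in> parcs G"
    by (auto simp: nbrs_def)
  obtain l l' where l: "l \<in> leaves G" "avoid b c l" "l' \<in> leaves G" "avoid b c' l'"
    using bc ex_leaf_avoid by meson
  have "l \<noteq> l'"
    using l bc c nbrs_not_avoid avoid_sym avoid_trans by metis
  moreover have "\<not> avoid b l y" "\<not> avoid b l' y"
    using l a bc c nbrs_not_avoid avoid_sym avoid_trans by metis+
  ultimately show ?thesis
    using l by blast
qed

text \<open>The internal vertices of a path in a tree are exactly those that separate its ends, so
  shortest paths can be traded for separation.\<close>

lemma visible_iff:
  assumes "u \<in> pverts G" "v \<in> pverts G"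
  shows "visible G X u v \<longleftrightarrow> (\<forall>x\<in>X - {u, v}. avoid x u v)"
proof -
  have internal: "internal_verts p = set p - {u, v}" if p: "vpath_between G u p v" for p
  proof (cases p)
    case (Cons a q)
    show ?thesis
    proof (cases q rule: rev_cases)
      case Nil
      then show ?thesis
        using p Cons by (auto simp: vpath_between_iff internal_verts_def)
    next
      case (snoc r b)
      then show ?thesis
        using p Cons by (auto simp: vpath_between_iff internal_verts_def butlast_append)
    qed
  qed (use p in \<open>simp add: vpath_between_iff\<close>)
  show ?thesis
  proof
    assume "visible G X u v"
    then obtain p where p: "vpath_between G u p v" "internal_verts p \<inter> X = {}"
      by (auto simp: visible_def shortest_vpath_def)
    show "\<forall>x\<in>X - {u, v}. avoid x u v"
    proof
      fix x assume "x \<in> X - {u, v}"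
      then have "x \<notin> set p"
        using p internal by blast
      then show "avoid x u v"
        using p successively_avoid[of p x] by (auto simp: vpath_between_iff)
    qed
  next
    assume av: "\<forall>x\<in>X - {u, v}. avoid x u v"
    obtain p0 where p0: "vpath_between G u p0 v"
      using ex_vpath_between assms by blast
    obtain p where p: "vpath_between G u p v"
        "\<And>q. vpath_between G u q v \<Longrightarrow> vwalk_length p \<le> vwalk_length q"
      using ex_has_least_nat[of "\<lambda>p. vpath_between G u p v", OF p0] by metis
    \<comment> \<open>Any internal vertex of \<open>p\<close> separates \<open>u\<close> from
      \<open>v\<close>, whereas by \<open>av\<close> no other member of \<open>X\<close>
      does.\<close>
    moreover have "internal_verts p \<inter> X = {}"
      using av internal[OF p(1)] vpath_between_not_avoid[OF p(1)] by blast
    ultimately show "visible G X u v"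
      unfolding visible_def shortest_vpath_def by blast
  qed
qed

text \<open>Exchanging quantifiers puts the blocking vertex first, which is the form the separation
  arguments need.\<close>

lemma mutual_visibility_set_iff:
  "mutual_visibility_set G X \<longleftrightarrow>
     X \<subseteq> pverts G \<and> (\<forall>x\<in>X. \<forall>u\<in>X - {x}. \<forall>v\<in>X - {x}. avoid x u v)"
proof -
  have "(\<forall>u\<in>X. \<forall>v\<in>X. \<forall>x\<in>X - {u, v}. avoid x u v) \<longleftrightarrow>
      (\<forall>x\<in>X. \<forall>u\<in>X - {x}. \<forall>v\<in>X - {x}. avoid x u v)"
    by auto
  then show ?thesis
    using visible_iff by (auto simp: mutual_visibility_set_def subset_iff)
qed

subsection \<open>Legs\<close>

text \<open>
  Up to its first branch vertex, a path starting in a leaf has no choice: two paths that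
  part at a vertex give it two forward neighbours and, unless it is the leaf, a backward one.
\<close>

lemma paths_from_leaf_prefix:
  assumes u: "u \<in> leaves G"
    and p: "vpath_between G u p v" "set (butlast p) \<inter> branch_verts G = {}"
    and q: "vpath_between G u q w"
  shows "prefix p q \<or> prefix q p"
proof (rule ccontr)
  assume "\<not> ?thesis"
  then have "parallel p q"
    by blast
  then obtain as b bs c cs where dec: "b \<noteq> c" "p = as @ b # bs" "q = as @ c # cs"
    using parallel_decomp by blast
  have "as \<noteq> []"
    using dec p q by (auto simp: vpath_between_iff)
  then obtain as' z where as: "as = as' @ [z]"
    by (cases as rule: rev_cases) auto
  have z: "z \<in> pverts G" "b \<in> nbrs z" "c \<in> nbrs z"
    using p q dec as by (auto simp: vpath_between_iff successively_append_iff nbrs_def)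
  have "z \<in> set (butlast p)"
    using dec as by (auto simp: butlast_append)
  then have small: "card (nbrs z) < 3"
    using p z by (auto simp: mem_branch_verts_iff)
  show False
  proof (cases "as' = []")
    case True
    then have "z = u"
      using p dec as by (auto simp: vpath_between_iff)
    then show False
      using u z dec by (auto simp: mem_leaves_iff card_1_singleton_iff)
  next
    case False
    then have "last as' \<in> nbrs z"
      using p dec as arc_sym by (auto simp: vpath_between_iff successively_append_iff nbrs_def)
    moreover have "last as' \<noteq> b" "last as' \<noteq> c"
      using p q dec as False by (auto simp: vpath_between_iff)
    ultimately have "card {last as', b, c} = 3" "{last as', b, c} \<subseteq> nbrs z"
      using dec z by auto
    then show False
      using small card_mono[OF finite_nbrs] by (metis not_less)
  qed
qed

text \<open>A proper extension with the same end would visit \<open>v\<close> twice. With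
  \<open>paths_from_leaf_prefix\<close> this gives uniqueness of the leg.\<close>

lemma vpath_between_prefix_eq:
  assumes "vpath_between G u p v" "vpath_between G u q v" "prefix p q"
  shows "p = q"
proof -
  obtain r where r: "q = p @ r"
    using assms(3) by (auto simp: prefix_def)
  have "r = []"
  proof (rule ccontr)
    assume "r \<noteq> []"
    then have "v \<in> set p" "v \<in> set r"
      using assms r last_in_set by (metis vpath_between_iff, metis last_appendR vpath_between_iff)
    then show False
      using assms r by (auto simp: vpath_between_iff)
  qed
  then show ?thesis
    using r by simp
qed

section \<open>Distances and the leg of a leaf\<close>

lemma graph_dist_attained:
  assumes "u \<in> pverts G" "v \<in> pverts G"
  shows "\<exists>p. vpath_between G u p v \<and> graph_dist G u v = vwalk_length p"
  using LeastI_ex[of "\<lambda>n. \<exists>p. vpath_between G u p v \<and> vwalk_length p = n"]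
    ex_vpath_between[OF assms] unfolding graph_dist_def by metis

lemma graph_dist_le: "vpath_between G u p v \<Longrightarrow> graph_dist G u v \<le> vwalk_length p"
  unfolding graph_dist_def by (rule Least_le) blast

lemma leaf_not_branch: "u \<in> leaves G \<Longrightarrow> u \<notin> branch_verts G"
  by (auto simp: mem_leaves_iff mem_branch_verts_iff)

text \<open>Take a shortest path \<open>p\<close> from \<open>u\<close> to any branch vertex.
  Minimality keeps earlier branch vertices off \<open>p\<close>, and
  \<open>paths_from_leaf_prefix\<close> then makes \<open>p\<close> unique, so both definite
  descriptions resolve: the nearest branch vertex is the end of \<open>p\<close>, and the leg is
  \<open>p\<close>.\<close>

lemma leg_props:
  assumes u: "u \<in> leaves G" and B: "branch_verts G \<noteq> {}"
  shows "\<exists>b\<in>branch_verts G. vpath_between G u (leg G u) b \<and>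
    set (butlast (leg G u)) \<inter> branch_verts G = {}"
proof -
  let ?P = "\<lambda>p. \<exists>b\<in>branch_verts G. vpath_between G u p b"
  have uV: "u \<in> pverts G" and BV: "branch_verts G \<subseteq> pverts G"
    using u by (auto simp: mem_leaves_iff mem_branch_verts_iff)
  obtain p0 where "?P p0"
    using B BV uV ex_vpath_between by blast
  then obtain p where "?P p" and min: "\<And>q. ?P q \<Longrightarrow> length p \<le> length q"
    using ex_has_least_nat[of ?P p0 length] by blast
  then obtain b where b: "b \<in> branch_verts G" "vpath_between G u p b"
    by blast
  have clean: "set (butlast p) \<inter> branch_verts G = {}"
  proof (rule ccontr)
    assume "\<not> ?thesis"
    then obtain c where c: "c \<in> set (butlast p)" "c \<in> branch_verts G"
      by blast
    have "butlast p @ [b] = p"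
      using b by (auto simp: vpath_between_iff)
    then obtain r s where "p = (r @ [c]) @ s @ [b]"
      using split_list[OF c(1)] by (metis append.assoc append_Cons append_Nil)
    then have "vpath_between G u (r @ [c]) c" "length (r @ [c]) < length p"
      using b by (auto simp: vpath_between_iff successively_append_iff hd_append
          split: if_splits)
    then show False
      using min[of "r @ [c]"] c by auto
  qed
  have unique: "q = p" if "c \<in> branch_verts G" "vpath_between G u q c" "length q \<le> length p" for c q
  proof -
    have "length q = length p"
      using min[of q] that by fastforce
    then show ?thesis
      using paths_from_leaf_prefix[OF u b(2) clean that(2)]
      by (auto simp: prefix_def)
  qed
  have pos: "length q > 0" if "vpath_between G u q c" for q c
    using that by (auto simp: vpath_between_iff)
  have near: "graph_dist G u b \<le> graph_dist G u c" if c: "c \<in> branch_verts G" for c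
  proof -
    obtain q where q: "vpath_between G u q c" "graph_dist G u c = vwalk_length q"
      using graph_dist_attained[of u c] c uV BV by blast
    then have "length p \<le> length q"
      using c by (intro min) blast
    then show ?thesis
      using q graph_dist_le[OF b(2)] by simp
  qed
  have nearest: "nearest_branch_vert G u = b"
    unfolding nearest_branch_vert_def
  proof (rule the_equality)
    fix c assume c: "c \<in> branch_verts G \<and> (\<forall>d\<in>branch_verts G. graph_dist G u c \<le> graph_dist G u d)"
    then obtain q where q: "vpath_between G u q c" "graph_dist G u c = vwalk_length q"
      using graph_dist_attained[of u c] uV BV by (meson subsetD)
    have "vwalk_length q \<le> vwalk_length p"
      using q c b graph_dist_le[OF b(2)] by (metis order_trans)
    \<comment> \<open>\<open>vwalk_length\<close> is \<open>length\<close> minus one, truncated at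
      zero; as the lists are nonempty, the comparison carries over.\<close>
    then have "length q \<le> length p"
      using pos[OF q(1)] pos[OF b(2)] unfolding vwalk_length_simp by linarith
    then have "q = p"
      using unique[of c q] c q by blast
    then show "c = b"
      using q b by (auto simp: vpath_between_iff)
  qed (use b near in blast)
  have "leg G u = p"
    unfolding leg_def nearest
    using b(2) vpath_between_prefix_eq paths_from_leaf_prefix[OF u b(2) clean]
    by (intro the_equality) blast+
  then show ?thesis
    using b clean by blast
qed

end

section \<open>Open legs: legs without their branch end\<close>

locale branched_tree = undirected_tree_graph +
  assumes branch_verts_nonempty: "branch_verts G \<noteq> {}"
begin

text \<open>Dropping the branch end leaves as many vertices as the leg has edges, so each leaf
  contributes \<open>leg_length\<close> choices.\<close>

definition open_leg :: "'a \<Rightarrow> 'a set" where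
  "open_leg u = set (butlast (leg G u))"

lemma legE:
  assumes "u \<in> leaves G"
  obtains b where "b \<in> branch_verts G" "b \<noteq> u" "vpath_between G u (leg G u) b"
    "set (leg G u) = insert b (open_leg u)" "b \<notin> open_leg u"
    "open_leg u \<inter> branch_verts G = {}"
proof -
  obtain b where b: "b \<in> branch_verts G" "vpath_between G u (leg G u) b"
      "open_leg u \<inter> branch_verts G = {}"
    using leg_props[OF assms branch_verts_nonempty] by (auto simp: open_leg_def)
  then have "set (leg G u) = insert b (open_leg u)"
    by (cases "leg G u" rule: rev_cases) (auto simp: vpath_between_iff open_leg_def)
  then show ?thesis
    using that b leaf_not_branch[OF assms] by blast
qed

lemma card_open_leg:
  assumes "u \<in> leaves G"
  shows "card (open_leg u) = leg_length G u"
  using legE[OF assms]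
  by (metis distinct_butlast distinct_card length_butlast leg_length_def open_leg_def
      vpath_between_iff vwalk_length_simp)

lemma open_leg_subset: "u \<in> leaves G \<Longrightarrow> open_leg u \<subseteq> pverts G"
  by (erule legE) (auto simp: vpath_between_iff)

lemma leaf_in_open_leg:
  assumes "u \<in> leaves G"
  shows "u \<in> open_leg u"
  using assms
proof (rule legE)
  fix b assume "b \<noteq> u" "vpath_between G u (leg G u) b" "set (leg G u) = insert b (open_leg u)"
  moreover from this have "u \<in> set (leg G u)"
    by (metis hd_in_set vpath_between_iff)
  ultimately show ?thesis
    by auto
qed

text \<open>Inside the leg of \<open>u\<close>, the vertex \<open>v\<close> would have both a
  predecessor and a successor as neighbours.\<close>

lemma leaf_notin_open_leg:
  assumes "u \<in> leaves G" "v \<in> leaves G" "u \<noteq> v"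
  shows "v \<notin> open_leg u"
proof
  assume "v \<in> open_leg u"
  obtain b where b: "b \<in> branch_verts G" "vpath_between G u (leg G u) b"
      "set (leg G u) = insert b (open_leg u)"
    using legE[OF assms(1)] by metis
  have vb: "v \<noteq> b"
    using b leaf_not_branch assms by blast
  obtain r s where dec: "leg G u = r @ v # s"
    using b \<open>v \<in> open_leg u\<close> split_list[of v "leg G u"] by auto
  then have "r \<noteq> []" "s \<noteq> []"
    using b vb assms(3) by (auto simp: vpath_between_iff)
  then have "last r \<in> nbrs v" "hd s \<in> nbrs v"
    using b dec arc_sym
    by (auto simp: vpath_between_iff successively_append_iff successively_Cons nbrs_def)
  moreover have "last r \<noteq> hd s"
    using b dec last_in_set[OF \<open>r \<noteq> []\<close>] hd_in_set[OF \<open>s \<noteq> []\<close>]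
    by (auto simp: vpath_between_iff)
  ultimately show False
    using assms(2) by (auto simp: mem_leaves_iff card_1_singleton_iff)
qed

text \<open>A path from \<open>w\<close> to a vertex off the open leg must run through the whole leg
  first; its remainder joins the branch end to that vertex without meeting \<open>z\<close>.\<close>

lemma avoid_open_leg:
  assumes w: "w \<in> leaves G" and z: "z \<in> open_leg w"
    and x: "x \<in> pverts G - open_leg w" and y: "y \<in> pverts G - open_leg w"
  shows "avoid z x y"
proof -
  obtain b where b: "b \<in> branch_verts G" "vpath_between G w (leg G w) b"
      "set (leg G w) = insert b (open_leg w)" "b \<notin> open_leg w"
      "set (butlast (leg G w)) \<inter> branch_verts G = {}"
    using legE[OF w] by (metis open_leg_def)
  have to_b: "avoid z b v" if v: "v \<in> pverts G - open_leg w" for v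
  proof (cases "v = b")
    case False
    obtain q where q: "vpath_between G w q v"
      using ex_vpath_between w v by (meson DiffD1 mem_leaves_iff)
    have "\<not> prefix q (leg G w)"
    proof
      assume "prefix q (leg G w)"
      then have "v \<in> set (leg G w)"
        using q set_mono_prefix by (metis last_in_set subsetD vpath_between_iff)
      then show False
        using v False b by blast
    qed
    then obtain r where r: "q = leg G w @ r"
      using paths_from_leaf_prefix[OF w b(2,5) q] by (auto simp: prefix_def)
    moreover have "leg G w = butlast (leg G w) @ [b]"
      using b by (auto simp: vpath_between_iff)
    ultimately have "q = butlast (leg G w) @ b # r"
      by (metis append.assoc append_Cons append_Nil)
    \<comment> \<open>As \<open>q\<close> is distinct and \<open>z\<close> lies in its part before
      \<open>b\<close>, the part from \<open>b\<close> onwards misses \<open>z\<close>.\<close>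
    then show ?thesis
      using q z successively_avoid[of "b # r" z]
      by (auto simp: vpath_between_iff successively_append_iff open_leg_def)
  qed simp
  show ?thesis
    using to_b[OF x] to_b[OF y] avoid_sym avoid_trans by blast
qed

text \<open>A common vertex \<open>x\<close> would lie strictly between \<open>v\<close> and the
  branch end of its leg and so separate them. Both lie outside the open leg of \<open>u\<close>, so
  \<open>avoid_open_leg\<close> joins them off \<open>x\<close>.\<close>

lemma open_leg_disjoint:
  assumes "u \<in> leaves G" "v \<in> leaves G" "u \<noteq> v"
  shows "open_leg u \<inter> open_leg v = {}"
proof (rule ccontr)
  assume "\<not> ?thesis"
  then obtain x where x: "x \<in> open_leg u" "x \<in> open_leg v"
    by blast
  obtain b where b: "b \<in> branch_verts G" "vpath_between G v (leg G v) b"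
      "set (leg G v) = insert b (open_leg v)" "b \<notin> open_leg v"
    using legE[OF assms(2)] by metis
  have "b \<notin> open_leg u"
    using legE[OF assms(1)] b by (metis disjoint_iff)
  then have "avoid x v b"
    using avoid_open_leg[OF assms(1) x(1)] leaf_notin_open_leg[OF assms] b assms(2)
    by (auto simp: mem_leaves_iff mem_branch_verts_iff)
  moreover have "x \<noteq> v"
    using x leaf_notin_open_leg[OF assms] by blast
  ultimately show False
    using vpath_between_not_avoid[OF b(2), of x] b x by auto
qed

text \<open>The path from \<open>u\<close> to \<open>x\<close> is comparable with the leg. If it
  contained the leg, the branch end would separate \<open>u\<close> from \<open>x\<close>.\<close>

lemma in_open_legI:
  assumes u: "u \<in> leaves G" and x: "x \<in> pverts G"
    and av: "\<And>b. b \<in> branch_verts G \<Longrightarrow> avoid b u x"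
  shows "x \<in> open_leg u"
proof -
  obtain b where b: "b \<in> branch_verts G" "b \<noteq> u" "vpath_between G u (leg G u) b"
      "set (leg G u) = insert b (open_leg u)"
      "set (butlast (leg G u)) \<inter> branch_verts G = {}"
    using legE[OF u] by (metis open_leg_def)
  have "x \<noteq> b"
    using avoid_neq[OF av[OF b(1)]] b by simp
  obtain q where q: "vpath_between G u q x"
    using ex_vpath_between u x by (meson mem_leaves_iff)
  consider "prefix (leg G u) q" | "prefix q (leg G u)"
    using paths_from_leaf_prefix[OF u b(3,5) q] by blast
  then show ?thesis
  proof cases
    case 1
    then have "b \<in> set q"
      using b(4) set_mono_prefix by blast
    then show ?thesis
      using vpath_between_not_avoid[OF q] av b \<open>x \<noteq> b\<close> by blast
  next
    case 2
    then have "x \<in> set (leg G u)"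
      using q set_mono_prefix by (metis last_in_set subsetD vpath_between_iff)
    then show ?thesis
      using b \<open>x \<noteq> b\<close> by blast
  qed
qed

subsection \<open>Maximum mutual-visibility sets\<close>

definition leaves_behind :: "'a set \<Rightarrow> 'a \<Rightarrow> 'a set" where
  "leaves_behind X x = {l \<in> leaves G. \<forall>y\<in>X - {x}. \<not> avoid x l y}"

text \<open>By \<open>avoid_trichotomy\<close> every leaf reaches \<open>x'\<close> off
  \<open>x\<close> or \<open>x\<close> off \<open>x'\<close>, so it fails to be behind one of
  them.\<close>

lemma leaves_behind_disjoint:
  assumes "X \<subseteq> pverts G" "x \<in> X" "x' \<in> X" "x \<noteq> x'"
  shows "leaves_behind X x \<inter> leaves_behind X x' = {}"
  using avoid_trichotomy[of x x'] assms
  by (fastforce simp: leaves_behind_def mem_leaves_iff)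

text \<open>Unless \<open>x\<close> is a leaf, it has a neighbour off the direction of
  \<open>y\<close>. The component beyond it contains a leaf but no member of
  \<open>X\<close>.\<close>

lemma leaves_behind_nonempty:
  assumes X: "mutual_visibility_set G X" and x: "x \<in> X" "y \<in> X" "x \<noteq> y"
  shows "leaves_behind X x \<noteq> {}"
proof -
  have V: "x \<in> pverts G" "y \<in> pverts G"
    using X x by (auto simp: mutual_visibility_set_iff)
  have same: "avoid x z y" if "z \<in> X - {x}" for z
    using X x that by (auto simp: mutual_visibility_set_iff)
  obtain a where a: "(x, a) \<in> parcs G" "avoid x a y"
    using ex_nbr_avoid V x by blast
  show ?thesis
  proof (cases "x \<in> leaves G")
    case True
    \<comment> \<open>A leaf \<open>x\<close> counts as behind itself, since
      \<open>avoid x x z\<close> fails for every \<open>z\<close> other than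
      \<open>x\<close>.\<close>
    then have "x \<in> leaves_behind X x"
      using avoid_neq avoid_sym by (fastforce simp: leaves_behind_def)
    then show ?thesis
      by blast
  next
    case False
    then have "card (nbrs x) \<noteq> 1"
      using V by (auto simp: mem_leaves_iff)
    then obtain c where c: "(x, c) \<in> parcs G" "c \<noteq> a"
      using ex_other_nbr[of x a] a(1) by (auto simp: nbrs_def)
    obtain l where l: "l \<in> leaves G" "avoid x c l"
      using ex_leaf_avoid c by blast
    have "\<not> avoid x l z" if "z \<in> X - {x}" for z
      using same[OF that] l a c nbrs_not_avoid avoid_sym avoid_trans by metis
    then show ?thesis
      using l by (auto simp: leaves_behind_def)
  qed
qed

text \<open>By \<open>in_open_legI\<close> it suffices that no branch vertex obstructs the way from
  \<open>u\<close> to \<open>x\<close>. One that did would put a second leaf behind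
  \<open>x\<close>.\<close>

lemma leaves_behind_singleton:
  assumes X: "mutual_visibility_set G X" and x: "x \<in> X" "y \<in> X" "x \<noteq> y"
    and single: "leaves_behind X x = {u}"
  shows "x \<in> open_leg u"
proof (rule in_open_legI)
  show V: "x \<in> pverts G"
    using X x by (auto simp: mutual_visibility_set_iff)
  show u: "u \<in> leaves G"
    using single by (auto simp: leaves_behind_def)
  fix b assume b: "b \<in> branch_verts G"
  show "avoid b u x"
  proof (rule ccontr)
    assume nav: "\<not> avoid b u x"
    have "\<exists>l\<in>leaves_behind X x. \<exists>l'\<in>leaves_behind X x. l \<noteq> l'"
    proof (cases "x = b")
      case True
      have yV: "y \<in> pverts G"
        using X x by (auto simp: mutual_visibility_set_iff)
      have "avoid x z y" if "z \<in> X - {x}" for z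
        using X x that by (auto simp: mutual_visibility_set_iff)
      then have "l \<in> leaves_behind X x" if "l \<in> leaves G" "\<not> avoid x l y" for l
        using that avoid_trans unfolding leaves_behind_def by blast
      then show ?thesis
        using ex_two_leaves[OF b yV] x True by metis
    next
      case False
      have "l \<in> leaves_behind X x" if l: "l \<in> leaves G" "\<not> avoid b l x" for l
      proof -
        \<comment> \<open>Both \<open>u\<close> and \<open>l\<close> are cut off from
          \<open>x\<close> at \<open>b\<close>, so they reach \<open>b\<close> off \<open>x\<close>
          and share a component. As \<open>u\<close> is behind \<open>x\<close>, so is
          \<open>l\<close>.\<close>
        have "avoid x u b" "avoid x l b"
          using avoid_trichotomy[OF False _ V] u l nav by (auto simp: mem_leaves_iff)
        then have "avoid x u l"
          using avoid_sym avoid_trans by blast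
        then have "\<not> avoid x l z" if "z \<in> X - {x}" for z
          using that single avoid_trans unfolding leaves_behind_def by blast
        then show ?thesis
          using l by (auto simp: leaves_behind_def)
      qed
      then show ?thesis
        using ex_two_leaves[OF b V False] by metis
    qed
    then show False
      using single by auto
  qed
qed

text \<open>Settles the bound for sets with at most one vertex, and ensures that a set attaining the
  bound has two.\<close>

lemma two_le_card_leaves: "2 \<le> card (leaves G)"
proof -
  obtain b where b: "b \<in> branch_verts G"
    using branch_verts_nonempty by blast
  then have "nbrs b \<noteq> {}"
    by (auto simp: mem_branch_verts_iff)
  then obtain a where "(b, a) \<in> parcs G"
    by (auto simp: nbrs_def)
  then obtain l l' where "l \<in> leaves G" "l' \<in> leaves G" "l \<noteq> l'"
    using ex_two_leaves[OF b, of a] arc_in_pverts arc_neq by metis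
  then have "{l, l'} \<subseteq> leaves G" "card {l, l'} = 2"
    by auto
  then show ?thesis
    using card_mono[OF finite_leaves] by metis
qed

text \<open>Any choice from nonempty, pairwise disjoint sets is injective. It serves both the bound
  and its equality case.\<close>

lemma leaves_behind_selector:
  assumes X: "mutual_visibility_set G X" and "2 \<le> card X"
  obtains s where "inj_on s X" "\<And>x. x \<in> X \<Longrightarrow> s x \<in> leaves_behind X x"
proof -
  have "leaves_behind X x \<noteq> {}" if "x \<in> X" for x
  proof -
    have "finite X"
      using assms(2) by (metis card.infinite not_numeral_le_zero)
    then have "\<not> X \<subseteq> {x}"
      using assms(2) card_mono[of "{x}" X] by auto
    then show ?thesis
      using leaves_behind_nonempty[OF X that] by blast
  qed
  then have s: "(SOME l. l \<in> leaves_behind X x) \<in> leaves_behind X x" if "x \<in> X" for x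
    using that by (metis some_in_eq)
  moreover have "inj_on (\<lambda>x. SOME l. l \<in> leaves_behind X x) X"
  proof (rule inj_onI, rule ccontr)
    fix x x' assume "x \<in> X" "x' \<in> X" "x \<noteq> x'"
      "(SOME l. l \<in> leaves_behind X x) = (SOME l. l \<in> leaves_behind X x')"
    then show False
      using s[of x] s[of x'] leaves_behind_disjoint[of X x x'] X
      by (auto simp: mutual_visibility_set_iff)
  qed
  ultimately show ?thesis
    using that by blast
qed

lemma card_mutual_visibility_set_le:
  assumes X: "mutual_visibility_set G X"
  shows "card X \<le> card (leaves G)"
proof (cases "2 \<le> card X")
  case True
  obtain s where "inj_on s X" "\<And>x. x \<in> X \<Longrightarrow> s x \<in> leaves_behind X x"
    using leaves_behind_selector[OF X True] by blast
  moreover from this have "s ` X \<subseteq> leaves G"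
    by (auto simp: leaves_behind_def)
  ultimately show ?thesis
    using card_inj_on_le finite_leaves by blast
qed (use two_le_card_leaves in linarith)

text \<open>Equality makes the selector \<open>s\<close> a bijection onto the leaves. Its inverse is
  the required choice function.\<close>

lemma maximum_imp_transversal:
  assumes X: "mutual_visibility_set G X" and card: "card X = card (leaves G)"
  shows "\<exists>f\<in>PiE (leaves G) open_leg. X = f ` leaves G"
proof -
  have two: "2 \<le> card X"
    using card two_le_card_leaves by simp
  then have fin: "finite X"
    by (metis card.infinite not_numeral_le_zero)
  have XV: "X \<subseteq> pverts G"
    using X by (simp add: mutual_visibility_set_iff)
  obtain s where inj: "inj_on s X" and s: "\<And>x. x \<in> X \<Longrightarrow> s x \<in> leaves_behind X x"
    using leaves_behind_selector[OF X two] by blast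
  have img: "s ` X = leaves G"
    using s card card_image[OF inj] finite_leaves
    by (intro card_subset_eq) (auto simp: leaves_behind_def)
  have leg: "x \<in> open_leg (s x)" if x: "x \<in> X" for x
  proof -
    have "leaves_behind X x = {s x}"
    proof -
      \<comment> \<open>Every leaf is \<open>s x'\<close> for some \<open>x'\<close> in
        \<open>X\<close>, and disjointness leaves only \<open>x' = x\<close>.\<close>
      have "l = s x" if l: "l \<in> leaves_behind X x" for l
      proof -
        obtain x' where "x' \<in> X" "l = s x'"
          using l img by (auto simp: leaves_behind_def)
        then show ?thesis
          using leaves_behind_disjoint[OF XV x, of x'] s[of x'] l by blast
      qed
      then show ?thesis
        using s[OF x] by blast
    qed
    moreover obtain y where "y \<in> X" "x \<noteq> y"
      using two fin card_mono[of "{x}" X] by fastforce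
    ultimately show ?thesis
      using leaves_behind_singleton[OF X x] by blast
  qed
  \<comment> \<open>\<open>PiE\<close> demands the value \<open>undefined\<close> outside the
    leaves, hence \<open>restrict\<close>.\<close>
  let ?f = "restrict (inv_into X s) (leaves G)"
  have "?f \<in> PiE (leaves G) open_leg"
    using leg img by (auto simp: f_inv_into_f intro: inv_into_into)
      (metis f_inv_into_f imageI inv_into_into)
  moreover have "?f ` leaves G = X"
    using inj img by (metis image_restrict_eq inv_into_image_cancel subset_refl)
  ultimately show ?thesis
    by metis
qed

section \<open>Transversals of the open legs\<close>

lemma transversal_eq:
  assumes "f \<in> PiE (leaves G) open_leg" "u \<in> leaves G" "x \<in> f ` leaves G" "x \<in> open_leg u"
  shows "x = f u"
proof -
  obtain v where v: "v \<in> leaves G" "x = f v"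
    using assms(3) by blast
  then have "x \<in> open_leg v"
    using assms(1) by blast
  then show ?thesis
    using open_leg_disjoint[OF assms(2) v(1)] assms(4) v(2) by blast
qed

lemma transversal_inj:
  assumes "f \<in> PiE (leaves G) open_leg"
  shows "inj_on f (leaves G)"
proof (rule inj_onI, rule ccontr)
  fix u v assume uv: "u \<in> leaves G" "v \<in> leaves G" "f u = f v" "u \<noteq> v"
  then have "f u \<in> open_leg u" "f u \<in> open_leg v"
    using assms by (metis PiE_mem)+
  then show False
    using open_leg_disjoint uv by blast
qed

text \<open>Since \<open>f w\<close> is the only chosen vertex on the open leg of \<open>w\<close>,
  all others lie outside it, where \<open>avoid_open_leg\<close> applies.\<close>

lemma transversal_mutual_visibility_set:
  assumes f: "f \<in> PiE (leaves G) open_leg"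
  shows "mutual_visibility_set G (f ` leaves G)"
  unfolding mutual_visibility_set_iff
proof (intro conjI ballI)
  show "f ` leaves G \<subseteq> pverts G"
    using f open_leg_subset by (auto simp: PiE_iff)
  fix z x y
  assume "z \<in> f ` leaves G" and xy: "x \<in> f ` leaves G - {z}" "y \<in> f ` leaves G - {z}"
  then obtain w where w: "w \<in> leaves G" "z = f w"
    by blast
  then have "x \<notin> open_leg w" "y \<notin> open_leg w" "z \<in> open_leg w"
    using transversal_eq[OF f w(1)] xy PiE_mem[OF f w(1)] by blast+
  then show "avoid z x y"
    using avoid_open_leg[OF w(1), of z x y] xy \<open>f ` leaves G \<subseteq> pverts G\<close> by blast
qed

text \<open>The image meets the open leg of \<open>u\<close> in \<open>f u\<close> alone, so it
  determines \<open>f\<close>. Counting sets thus becomes counting functions.\<close>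

lemma inj_on_transversal: "inj_on (\<lambda>f. f ` leaves G) (PiE (leaves G) open_leg)"
proof (rule inj_onI)
  fix f g
  assume f: "f \<in> PiE (leaves G) open_leg" and g: "g \<in> PiE (leaves G) open_leg"
    and eq: "f ` leaves G = g ` leaves G"
  have "f u = g u" if "u \<in> leaves G" for u
    using transversal_eq[OF g that, of "f u"] eq f that by (auto simp: PiE_iff)
  then show "f = g"
    using f g by (meson PiE_ext)
qed

section \<open>The mutual-visibility number and the count of maximum sets\<close>

lemma mutual_visibility_number_eq: "mutual_visibility_number G = card (leaves G)"
  unfolding mutual_visibility_number_def
proof (rule Max_eqI)
  have "{X. mutual_visibility_set G X} \<subseteq> Pow (pverts G)"
    by (auto simp: mutual_visibility_set_def)
  then show "finite (card ` {X. mutual_visibility_set G X})"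
    using finite_pverts finite_subset by blast
  \<comment> \<open>The bound is attained by choosing each leaf on its own leg.\<close>
  have "restrict id (leaves G) \<in> PiE (leaves G) open_leg"
    using leaf_in_open_leg by auto
  from transversal_mutual_visibility_set[OF this] have "mutual_visibility_set G (leaves G)"
    by simp
  then show "card (leaves G) \<in> card ` {X. mutual_visibility_set G X}"
    by blast
next
  fix n
  assume "n \<in> card ` {X. mutual_visibility_set G X}"
  then show "n \<le> card (leaves G)"
    using card_mutual_visibility_set_le by blast
qed

lemma r_mu_eq: "r_mu G = (\<Prod>u\<in>leaves G. leg_length G u)"
proof -
  have "{X. mutual_visibility_set G X \<and> card X = mutual_visibility_number G} =
      (\<lambda>f. f ` leaves G) ` PiE (leaves G) open_leg"
    (is "?M = ?F")
  proof
    show "?M \<subseteq> ?F"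
      unfolding mutual_visibility_number_eq using maximum_imp_transversal by blast
    show "?F \<subseteq> ?M"
      unfolding mutual_visibility_number_eq
      using transversal_mutual_visibility_set card_image[OF transversal_inj] by blast
  qed
  then have "r_mu G = card (PiE (leaves G) open_leg)"
    by (simp add: r_mu_def card_image inj_on_transversal)
  also have "\<dots> = (\<Prod>u\<in>leaves G. leg_length G u)"
    by (simp add: card_PiE finite_leaves card_open_leg)
  finally show ?thesis .
qed

end

theorem theorem6:
  fixes T :: "'a pair_pre_digraph"
  assumes "undirected_tree T"
    and "branch_verts T \<noteq> {}"
  shows "r_mu T = (\<Prod>u\<in>leaves T. leg_length T u)"
proof -
  interpret branched_tree T
    using assms by unfold_locales
  show ?thesis
    by (rule r_mu_eq)
qed

end
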